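(* Let $(M^n,g)$, $n>3$, be a quasi-conformally flat weakly Ricci symmetric manifold with associated 1-forms $A,B,D$ and nowhere-vanishing scalar curvature $\gamma$, with $T=B-D$ nowhere zero. Then $M$ is a manifold of hyper quasi-constant curvature: $\bar R(X,Y,Z,W)=l[g(Y,Z)g(X,W)-g(X,Z)g(Y,W)]+g(X,W)P(Y,Z)-g(X,Z)P(Y,W)+g(Y,Z)P(X,W)-g(Y,W)P(X,Z)$ with $l=\frac{\gamma}{n}\left[\frac{1}{n-1}+\frac{2b}{a}\right]$ and $P=\delta(B\otimes B-B\otimes D-D\otimes B+D\otimes D)$, $\delta=-\frac{b}{a}\frac{\gamma}{T(\rho)}$, $g(X,\rho)=T(X)$.
   Context: A non-flat Riemannian manifold $(M^n,g)$, $n>2$, is weakly Ricci symmetric if its Ricci tensor $S$ satisfies $(\nabla_XS)(Z,U)=A(X)S(Z,U)+B(Z)S(X,U)+D(U)S(X,Z)$ for all vector fields, where $A,B,D$ are 1-forms, not all zero. $\bar R(X,Y,Z,W)=g(R(X,Y)Z,W)$. The quasi-conformal curvature tensor is $C^*(X,Y)Z=aR(X,Y)Z+b[S(Y,Z)X-S(X,Z)Y+g(Y,Z)QX-g(X,Z)QY]-\frac{\gamma}{n}\left[\frac{a}{n-1}+2b\right][g(Y,Z)X-g(X,Z)Y]$, $a\neq0,b$ constants, $Q$ the Ricci operator, $\gamma$ the scalar curvature; quasi-conformally flat means $C^*=0$. A manifold of hyper quasi-constant curvature has curvature tensor of the displayed form with a non-zero scalar and a $(0,2)$ tensor $P$.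 *)

theory Defs
  imports "HOL-Analysis.Analysis"
begin

(* Riemannian manifold rendered in a single coordinate chart: an open set U of real^'n
   with metric components g x i j.  Vectors / 1-forms at a point are elements of real^'n
   (components w.r.t. the coordinate frame / coframe). *)

definition pd :: "(real^'n \<Rightarrow> real) \<Rightarrow> 'n \<Rightarrow> real^'n \<Rightarrow> real" where
  "pd f i x = frechet_derivative f (at x) (axis i 1)"

fun Ck :: "nat \<Rightarrow> (real^'n) set \<Rightarrow> (real^'n \<Rightarrow> real) \<Rightarrow> bool" where
  "Ck 0 U f = continuous_on U f"
| "Ck (Suc k) U f = (f differentiable_on U \<and> (\<forall>i. Ck k U (pd f i)))"

definition smooth_on :: "(real^'n) set \<Rightarrow> (real^'n \<Rightarrow> real) \<Rightarrow> bool" where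
  "smooth_on U f = (\<forall>k. Ck k U f)"

definition riemannian_metric :: "(real^'n) set \<Rightarrow> (real^'n \<Rightarrow> 'n \<Rightarrow> 'n \<Rightarrow> real) \<Rightarrow> bool" where
  "riemannian_metric U g =
     (open U \<and> (\<forall>i j. smooth_on U (\<lambda>x. g x i j))
      \<and> (\<forall>x\<in>U. \<forall>i j. g x i j = g x j i)
      \<and> (\<forall>x\<in>U. \<forall>v::real^'n. v \<noteq> 0 \<longrightarrow> (\<Sum>i\<in>UNIV. \<Sum>j\<in>UNIV. g x i j * v$i * v$j) > 0))"

definition ginv :: "(real^'n \<Rightarrow> 'n \<Rightarrow> 'n \<Rightarrow> real) \<Rightarrow> real^'n \<Rightarrow> 'n \<Rightarrow> 'n \<Rightarrow> real" where
  "ginv g x i j = matrix_inv (\<chi> a b. g x a b) $ i $ j"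

definition Chr :: "(real^'n \<Rightarrow> 'n \<Rightarrow> 'n \<Rightarrow> real) \<Rightarrow> 'n \<Rightarrow> 'n \<Rightarrow> 'n \<Rightarrow> real^'n \<Rightarrow> real" where
  "Chr g k i j x = (1/2) * (\<Sum>l\<in>UNIV. ginv g x k l *
      (pd (\<lambda>y. g y j l) i x + pd (\<lambda>y. g y i l) j x - pd (\<lambda>y. g y i j) l x))"

(* R(d_i,d_j)d_k = Riem l i j k d_l, with R(X,Y)Z = nabla_X nabla_Y Z - nabla_Y nabla_X Z - nabla_[X,Y] Z *)
definition Riem :: "(real^'n \<Rightarrow> 'n \<Rightarrow> 'n \<Rightarrow> real) \<Rightarrow> 'n \<Rightarrow> 'n \<Rightarrow> 'n \<Rightarrow> 'n \<Rightarrow> real^'n \<Rightarrow> real" where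
  "Riem g l i j k x = pd (\<lambda>y. Chr g l j k y) i x - pd (\<lambda>y. Chr g l i k y) j x
     + (\<Sum>m\<in>UNIV. Chr g l i m x * Chr g m j k x - Chr g l j m x * Chr g m i k x)"

definition gval :: "(real^'n \<Rightarrow> 'n \<Rightarrow> 'n \<Rightarrow> real) \<Rightarrow> real^'n \<Rightarrow> real^'n \<Rightarrow> real^'n \<Rightarrow> real" where
  "gval g x X Y = (\<Sum>i\<in>UNIV. \<Sum>j\<in>UNIV. g x i j * X$i * Y$j)"

definition curv_op :: "(real^'n \<Rightarrow> 'n \<Rightarrow> 'n \<Rightarrow> real) \<Rightarrow> real^'n \<Rightarrow> real^'n \<Rightarrow> real^'n \<Rightarrow> real^'n \<Rightarrow> real^'n" where
  "curv_op g x X Y Z = (\<chi> l. \<Sum>i\<in>UNIV. \<Sum>j\<in>UNIV. \<Sum>k\<in>UNIV. Riem g l i j k x * X$i * Y$j * Z$k)"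

definition Rbar :: "(real^'n \<Rightarrow> 'n \<Rightarrow> 'n \<Rightarrow> real) \<Rightarrow> real^'n \<Rightarrow> real^'n \<Rightarrow> real^'n \<Rightarrow> real^'n \<Rightarrow> real^'n \<Rightarrow> real" where
  "Rbar g x X Y Z W = gval g x (curv_op g x X Y Z) W"

definition Ric :: "(real^'n \<Rightarrow> 'n \<Rightarrow> 'n \<Rightarrow> real) \<Rightarrow> 'n \<Rightarrow> 'n \<Rightarrow> real^'n \<Rightarrow> real" where
  "Ric g j k x = (\<Sum>i\<in>UNIV. Riem g i i j k x)"

definition ricci :: "(real^'n \<Rightarrow> 'n \<Rightarrow> 'n \<Rightarrow> real) \<Rightarrow> real^'n \<Rightarrow> real^'n \<Rightarrow> real^'n \<Rightarrow> real" where
  "ricci g x Y Z = (\<Sum>j\<in>UNIV. \<Sum>k\<in>UNIV. Ric g j k x * Y$j * Z$k)"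

(* Ricci operator Q: g(QX,Y) = S(X,Y) *)
definition ricci_op :: "(real^'n \<Rightarrow> 'n \<Rightarrow> 'n \<Rightarrow> real) \<Rightarrow> real^'n \<Rightarrow> real^'n \<Rightarrow> real^'n" where
  "ricci_op g x X = (\<chi> i. \<Sum>j\<in>UNIV. \<Sum>k\<in>UNIV. ginv g x i j * Ric g j k x * X$k)"

definition scal :: "(real^'n \<Rightarrow> 'n \<Rightarrow> 'n \<Rightarrow> real) \<Rightarrow> real^'n \<Rightarrow> real" where
  "scal g x = (\<Sum>j\<in>UNIV. \<Sum>k\<in>UNIV. ginv g x j k * Ric g j k x)"

(* components of nabla S: (nabla_{d_i} S)(d_j,d_k) *)
definition nablaRic :: "(real^'n \<Rightarrow> 'n \<Rightarrow> 'n \<Rightarrow> real) \<Rightarrow> 'n \<Rightarrow> 'n \<Rightarrow> 'n \<Rightarrow> real^'n \<Rightarrow> real" where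
  "nablaRic g i j k x = pd (\<lambda>y. Ric g j k y) i x
     - (\<Sum>m\<in>UNIV. Chr g m i j x * Ric g m k x + Chr g m i k x * Ric g j m x)"

definition nabla_ricci :: "(real^'n \<Rightarrow> 'n \<Rightarrow> 'n \<Rightarrow> real) \<Rightarrow> real^'n \<Rightarrow> real^'n \<Rightarrow> real^'n \<Rightarrow> real^'n \<Rightarrow> real" where
  "nabla_ricci g x X Z W = (\<Sum>i\<in>UNIV. \<Sum>j\<in>UNIV. \<Sum>k\<in>UNIV. nablaRic g i j k x * X$i * Z$j * W$k)"

definition oneform :: "(real^'n \<Rightarrow> real^'n) \<Rightarrow> real^'n \<Rightarrow> real^'n \<Rightarrow> real" where
  "oneform A x X = (\<Sum>i\<in>UNIV. A x $ i * X $ i)"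

definition non_flat :: "(real^'n) set \<Rightarrow> (real^'n \<Rightarrow> 'n \<Rightarrow> 'n \<Rightarrow> real) \<Rightarrow> bool" where
  "non_flat U g = (\<exists>x\<in>U. \<exists>X Y Z. curv_op g x X Y Z \<noteq> 0)"

definition weakly_ricci_symmetric ::
  "(real^'n) set \<Rightarrow> (real^'n \<Rightarrow> 'n \<Rightarrow> 'n \<Rightarrow> real) \<Rightarrow> (real^'n \<Rightarrow> real^'n) \<Rightarrow> (real^'n \<Rightarrow> real^'n) \<Rightarrow> (real^'n \<Rightarrow> real^'n) \<Rightarrow> bool" where
  "weakly_ricci_symmetric U g A B D =
     ((\<forall>x\<in>U. \<forall>X Z W. nabla_ricci g x X Z W =
         oneform A x X * ricci g x Z W + oneform B x Z * ricci g x X W + oneform D x W * ricci g x X Z)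
      \<and> (\<exists>x\<in>U. A x \<noteq> 0 \<or> B x \<noteq> 0 \<or> D x \<noteq> 0))"

definition qc_curv :: "(real^'n \<Rightarrow> 'n \<Rightarrow> 'n \<Rightarrow> real) \<Rightarrow> real \<Rightarrow> real \<Rightarrow> real^'n \<Rightarrow> real^'n \<Rightarrow> real^'n \<Rightarrow> real^'n \<Rightarrow> real^'n" where
  "qc_curv g a b x X Y Z =
     a *\<^sub>R curv_op g x X Y Z
     + b *\<^sub>R (ricci g x Y Z *\<^sub>R X - ricci g x X Z *\<^sub>R Y + gval g x Y Z *\<^sub>R ricci_op g x X - gval g x X Z *\<^sub>R ricci_op g x Y)
     - (scal g x / real CARD('n) * (a / (real CARD('n) - 1) + 2 * b)) *\<^sub>R (gval g x Y Z *\<^sub>R X - gval g x X Z *\<^sub>R Y)"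

definition quasi_conformally_flat :: "(real^'n) set \<Rightarrow> (real^'n \<Rightarrow> 'n \<Rightarrow> 'n \<Rightarrow> real) \<Rightarrow> real \<Rightarrow> real \<Rightarrow> bool" where
  "quasi_conformally_flat U g a b = (\<forall>x\<in>U. \<forall>X Y Z. qc_curv g a b x X Y Z = 0)"

(* the vector field rho with g(X,rho) = T(X), i.e. rho^i = g^{ij} T_j *)
definition dual_vec :: "(real^'n \<Rightarrow> 'n \<Rightarrow> 'n \<Rightarrow> real) \<Rightarrow> (real^'n \<Rightarrow> real^'n) \<Rightarrow> real^'n \<Rightarrow> real^'n" where
  "dual_vec g T x = (\<chi> i. \<Sum>j\<in>UNIV. ginv g x i j * T x $ j)"

end

theory Submission
  imports Defs
begin

text \<open>
  The Ricci tensor \<open>S\<close> and its covariant derivative are symmetric, so interchanging \<open>Z\<close> and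
  \<open>W\<close> in the weak Ricci symmetry condition leaves \<open>T(Z) S(X,W) = T(W) S(X,Z)\<close> with
  \<open>T = B - D\<close>. Putting \<open>W = \<rho>\<close> shows \<open>S = \<kappa> T \<otimes> T\<close>, and tracing gives
  \<open>\<kappa> = \<gamma> / T(\<rho>)\<close>. Contracting \<open>C* = 0\<close> with \<open>W\<close> expresses \<open>R\<close> through \<open>g\<close> and \<open>S\<close>;
  substituting \<open>S = (\<gamma>/T(\<rho>)) T \<otimes> T\<close> gives the hyper quasi-constant curvature form.

  In a chart the symmetry of \<open>S\<close> is not automatic. All terms of \<open>S_jk - S_kj\<close> cancel
  by the symmetry of the Christoffel symbols except \<open>d_k G_j - d_j G_k\<close>, where
  \<open>G_j = \<Gamma>^i_ij = 1/2 g^il d_j g_il\<close>. Differentiating, with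
  \<open>d g^-1 = - g^-1 (d g) g^-1\<close>, gives an expression symmetric in \<open>j, k\<close> by Schwarz's theorem.
\<close>

section \<open>Partial derivatives\<close>

lemma pd_transform_within_open:
  assumes "open U" "x \<in> U" "\<And>y. y \<in> U \<Longrightarrow> f y = h y"
  shows "pd f i x = pd h i x"
proof -
  have "(f has_derivative F) (at x) \<longleftrightarrow> (h has_derivative F) (at x)" for F
    using assms by (auto intro: has_derivative_transform_within_open)
  then show ?thesis
    unfolding pd_def frechet_derivative_def by simp
qed

lemma pd_has_derivative: "(f has_derivative F) (at x) \<Longrightarrow> pd f i x = F (axis i 1)"
  unfolding pd_def by (metis frechet_derivative_at)

lemma pd_const: "pd (\<lambda>y. c) i x = 0"
  unfolding pd_def by simp

lemma pd_mult:
  fixes f h :: "real^'n \<Rightarrow> real"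
  assumes "f differentiable at x" "h differentiable at x"
  shows "pd (\<lambda>y. f y * h y) i x = pd f i x * h x + f x * pd h i x"
  using pd_has_derivative[OF has_derivative_mult[OF assms[unfolded frechet_derivative_works]]]
  by (simp add: pd_def)

lemma pd_cmult:
  fixes f :: "real^'n \<Rightarrow> real"
  assumes "f differentiable at x"
  shows "pd (\<lambda>y. c * f y) i x = c * pd f i x"
  using pd_mult[OF differentiable_const assms] by (simp add: pd_const)

lemma pd_sum:
  fixes f :: "'a \<Rightarrow> real^'n \<Rightarrow> real"
  assumes "finite S" "\<And>a. a \<in> S \<Longrightarrow> f a differentiable at x"
  shows "pd (\<lambda>y. \<Sum>a\<in>S. f a y) i x = (\<Sum>a\<in>S. pd (f a) i x)"
proof -
  have "((\<lambda>y. \<Sum>a\<in>S. f a y) has_derivative (\<lambda>v. \<Sum>a\<in>S. frechet_derivative (f a) (at x) v)) (at x)"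
    using assms by (intro has_derivative_sum) (simp add: frechet_derivative_works)
  from pd_has_derivative[OF this] show ?thesis
    by (simp add: pd_def)
qed

lemma has_real_derivative_pd_axis:
  fixes f :: "real^'n \<Rightarrow> real"
  assumes "f differentiable at (z + t *\<^sub>R axis i 1)"
  shows "((\<lambda>s. f (z + s *\<^sub>R axis i 1)) has_real_derivative pd f i (z + t *\<^sub>R axis i 1)) (at t)"
proof -
  let ?F = "frechet_derivative f (at (z + t *\<^sub>R axis i 1))"
  have F: "(f has_derivative ?F) (at (z + t *\<^sub>R axis i 1))"
    using assms frechet_derivative_works by blast
  have "((\<lambda>s. z + s *\<^sub>R axis i 1) has_derivative (\<lambda>s. s *\<^sub>R axis i 1)) (at t)"
    by (auto intro!: derivative_eq_intros)
  from has_derivative_compose[OF this F]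
  have "((\<lambda>s. f (z + s *\<^sub>R axis i 1)) has_derivative (\<lambda>s. ?F (s *\<^sub>R axis i 1))) (at t)"
    by (simp add: o_def)
  moreover have "(\<lambda>s. ?F (s *\<^sub>R axis i 1)) = (*) (pd f i (z + t *\<^sub>R axis i 1))"
    using linear_scale[OF has_derivative_linear[OF F]] by (auto simp: pd_def)
  ultimately show ?thesis
    unfolding has_field_derivative_def by simp
qed

lemma second_difference_mvt:
  fixes f :: "real^'n \<Rightarrow> real"
  assumes U: "cball x (2*h) \<subseteq> U" and h: "0 < h"
    and f: "\<And>y. y \<in> U \<Longrightarrow> f differentiable at y"
    and fi: "\<And>y. y \<in> U \<Longrightarrow> pd f i differentiable at y"
  shows "\<exists>\<xi>. dist x \<xi> \<le> 2*h \<and>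
     f (x + h *\<^sub>R axis i 1 + h *\<^sub>R axis j 1) - f (x + h *\<^sub>R axis i 1) - f (x + h *\<^sub>R axis j 1) + f x
       = h\<^sup>2 * pd (pd f i) j \<xi>"
proof -
  let ?ei = "axis i (1::real)" and ?ej = "axis j (1::real)"
  have close: "dist x (x + s *\<^sub>R ?ei + u *\<^sub>R ?ej) \<le> 2*h"
    if "0 \<le> s" "s \<le> h" "0 \<le> u" "u \<le> h" for s u
    using norm_triangle_ineq[of "s *\<^sub>R ?ei" "u *\<^sub>R ?ej"] that
    by (subst dist_commute) (simp add: dist_norm)
  have inU: "x + s *\<^sub>R ?ei + u *\<^sub>R ?ej \<in> U"
    if "0 \<le> s" "s \<le> h" "0 \<le> u" "u \<le> h" for s u
    using close[OF that] U by auto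
  have "\<exists>s0. 0 < s0 \<and> s0 < h \<and>
      (f (x + h *\<^sub>R ?ej + h *\<^sub>R ?ei) - f (x + h *\<^sub>R ?ei)) - (f (x + h *\<^sub>R ?ej + 0 *\<^sub>R ?ei) - f (x + 0 *\<^sub>R ?ei))
        = (h - 0) * (pd f i (x + h *\<^sub>R ?ej + s0 *\<^sub>R ?ei) - pd f i (x + s0 *\<^sub>R ?ei))"
  proof (rule MVT2[OF h, of "\<lambda>s. f (x + h *\<^sub>R ?ej + s *\<^sub>R ?ei) - f (x + s *\<^sub>R ?ei)"])
    fix s :: real assume s: "0 \<le> s" "s \<le> h"
    have "f differentiable at (x + h *\<^sub>R ?ej + s *\<^sub>R ?ei)" "f differentiable at (x + s *\<^sub>R ?ei)"
      using f inU[of s h] inU[of s 0] s h by (simp_all add: add_ac)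
    then show "((\<lambda>s. f (x + h *\<^sub>R ?ej + s *\<^sub>R ?ei) - f (x + s *\<^sub>R ?ei)) has_real_derivative
        pd f i (x + h *\<^sub>R ?ej + s *\<^sub>R ?ei) - pd f i (x + s *\<^sub>R ?ei)) (at s)"
      by (intro DERIV_diff has_real_derivative_pd_axis)
  qed
  then obtain s0 where s0: "0 < s0" "s0 < h"
    "f (x + h *\<^sub>R ?ei + h *\<^sub>R ?ej) - f (x + h *\<^sub>R ?ei) - f (x + h *\<^sub>R ?ej) + f x
       = h * (pd f i (x + s0 *\<^sub>R ?ei + h *\<^sub>R ?ej) - pd f i (x + s0 *\<^sub>R ?ei))"
    by (auto simp: add_ac)
  have "\<exists>u0. 0 < u0 \<and> u0 < h \<and>
      pd f i (x + s0 *\<^sub>R ?ei + h *\<^sub>R ?ej) - pd f i (x + s0 *\<^sub>R ?ei + 0 *\<^sub>R ?ej)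
        = (h - 0) * pd (pd f i) j (x + s0 *\<^sub>R ?ei + u0 *\<^sub>R ?ej)"
    by (rule MVT2[OF h]) (use fi inU s0 in \<open>auto intro!: has_real_derivative_pd_axis\<close>)
  then obtain u0 where u0: "0 < u0" "u0 < h"
    "pd f i (x + s0 *\<^sub>R ?ei + h *\<^sub>R ?ej) - pd f i (x + s0 *\<^sub>R ?ei)
       = h * pd (pd f i) j (x + s0 *\<^sub>R ?ei + u0 *\<^sub>R ?ej)"
    by auto
  show ?thesis
  proof (intro exI conjI)
    show "dist x (x + s0 *\<^sub>R ?ei + u0 *\<^sub>R ?ej) \<le> 2*h"
      using close s0 u0 by simp
  qed (simp add: s0(3) u0(3) power2_eq_square)
qed

lemma pd_pd_commute:
  fixes f :: "real^'n \<Rightarrow> real"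
  assumes U: "open U" "x \<in> U"
    and f: "\<And>y. y \<in> U \<Longrightarrow> f differentiable at y"
    and fi: "\<And>y. y \<in> U \<Longrightarrow> pd f i differentiable at y"
    and fj: "\<And>y. y \<in> U \<Longrightarrow> pd f j differentiable at y"
    and cij: "continuous_on U (pd (pd f i) j)" and cji: "continuous_on U (pd (pd f j) i)"
  shows "pd (pd f i) j x = pd (pd f j) i x"
proof -
  let ?c1 = "pd (pd f i) j x" and ?c2 = "pd (pd f j) i x"
  have "\<bar>?c1 - ?c2\<bar> \<le> 0 + e" if e: "e > 0" for e
  proof -
    obtain r where r: "r > 0" "cball x r \<subseteq> U"
      using U open_contains_cball by blast
    obtain d1 where d1: "d1 > 0" "\<And>y. dist y x < d1 \<Longrightarrow> dist (pd (pd f i) j y) ?c1 < e/2"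
      using cij U e unfolding continuous_on_eq_continuous_at[OF U(1)] continuous_at_eps_delta
      by (meson half_gt_zero)
    obtain d2 where d2: "d2 > 0" "\<And>y. dist y x < d2 \<Longrightarrow> dist (pd (pd f j) i y) ?c2 < e/2"
      using cji U e unfolding continuous_on_eq_continuous_at[OF U(1)] continuous_at_eps_delta
      by (meson half_gt_zero)
    define h where "h = min r (min d1 d2) / 4"
    have h: "h > 0" "cball x (2*h) \<subseteq> U" "2*h < d1" "2*h < d2"
      using r d1 d2 by (auto simp: h_def)
    obtain \<xi> where \<xi>: "dist x \<xi> \<le> 2*h"
      "f (x + h *\<^sub>R axis i 1 + h *\<^sub>R axis j 1) - f (x + h *\<^sub>R axis i 1) - f (x + h *\<^sub>R axis j 1) + f x
         = h\<^sup>2 * pd (pd f i) j \<xi>"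
      using second_difference_mvt[OF h(2,1) f fi] by blast
    obtain \<eta> where \<eta>: "dist x \<eta> \<le> 2*h"
      "f (x + h *\<^sub>R axis j 1 + h *\<^sub>R axis i 1) - f (x + h *\<^sub>R axis j 1) - f (x + h *\<^sub>R axis i 1) + f x
         = h\<^sup>2 * pd (pd f j) i \<eta>"
      using second_difference_mvt[OF h(2,1) f fj] by blast
    have swap: "x + h *\<^sub>R axis j 1 + h *\<^sub>R axis i 1 = x + h *\<^sub>R axis i 1 + h *\<^sub>R axis j 1"
      by (simp add: add_ac)
    have "h\<^sup>2 * pd (pd f i) j \<xi> = h\<^sup>2 * pd (pd f j) i \<eta>"
      using \<xi>(2) \<eta>(2)[unfolded swap] by linarith
    then have "pd (pd f i) j \<xi> = pd (pd f j) i \<eta>"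
      using h(1) by simp
    moreover have "dist (pd (pd f i) j \<xi>) ?c1 < e/2" "dist (pd (pd f j) i \<eta>) ?c2 < e/2"
      using d1(2)[of \<xi>] d2(2)[of \<eta>] \<xi>(1) \<eta>(1) h by (simp_all add: dist_commute)
    ultimately show ?thesis
      unfolding dist_real_def by arith
  qed
  then show ?thesis
    using field_le_epsilon[of "\<bar>?c1 - ?c2\<bar>" 0] by simp
qed

lemma differentiable_prod:
  fixes f :: "'i \<Rightarrow> 'a::real_normed_vector \<Rightarrow> real"
  assumes "\<And>i. i \<in> I \<Longrightarrow> f i differentiable at x"
  shows "(\<lambda>y. \<Prod>i\<in>I. f i y) differentiable at x"
proof -
  have "((\<lambda>y. \<Prod>i\<in>I. f i y) has_derivative
      (\<lambda>v. \<Sum>i\<in>I. frechet_derivative (f i) (at x) v * (\<Prod>j\<in>I - {i}. f j x))) (at x)"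
    using assms by (intro has_derivative_prod) (simp add: frechet_derivative_works)
  then show ?thesis
    by (rule differentiableI)
qed

lemma differentiable_det:
  fixes M :: "'a::real_normed_vector \<Rightarrow> real^'n^'n"
  assumes "\<And>a b. (\<lambda>y. M y $ a $ b) differentiable at x"
  shows "(\<lambda>y. det (M y)) differentiable at x"
proof -
  have "(\<lambda>y. of_int (sign p) * (\<Prod>i\<in>UNIV. M y $ i $ p i)) differentiable at x" for p
    by (rule differentiable_mult[OF differentiable_const differentiable_prod]) (rule assms)
  then show ?thesis
    unfolding det_def by (intro differentiable_sum) auto
qed

lemma differentiable_transform_within_open:
  assumes "f differentiable at x" "open U" "x \<in> U" "\<And>y. y \<in> U \<Longrightarrow> f y = h y"
  shows "h differentiable at x"
  using assms has_derivative_transform_within_open unfolding differentiable_def by blast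

lemma invertible_matrix_inv:
  fixes M :: "'a::semiring_1^'n^'m"
  assumes "invertible M"
  shows "M ** matrix_inv M = mat 1" "matrix_inv M ** M = mat 1"
  using someI_ex[OF assms[unfolded invertible_def]] unfolding matrix_inv_def by auto

lemma sum_mult_axis: "(\<Sum>l\<in>UNIV. f l * axis j (1::real) $ l) = f j"
  by (simp add: axis_def flip: of_bool_def)

lemma sum3_rev:
  "(\<Sum>a\<in>A. \<Sum>b\<in>B. \<Sum>c\<in>C. F a b c) = (\<Sum>c\<in>C. \<Sum>b\<in>B. \<Sum>a\<in>A. F a b c)"
proof -
  have "(\<Sum>a\<in>A. \<Sum>b\<in>B. \<Sum>c\<in>C. F a b c) = (\<Sum>a\<in>A. \<Sum>c\<in>C. \<Sum>b\<in>B. F a b c)"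
    by (intro sum.cong refl sum.swap)
  also have "\<dots> = (\<Sum>c\<in>C. \<Sum>a\<in>A. \<Sum>b\<in>B. F a b c)"
    by (rule sum.swap)
  also have "\<dots> = (\<Sum>c\<in>C. \<Sum>b\<in>B. \<Sum>a\<in>A. F a b c)"
    by (intro sum.cong refl sum.swap)
  finally show ?thesis .
qed

lemma sum4_rev:
  "(\<Sum>a\<in>A. \<Sum>b\<in>B. \<Sum>c\<in>C. \<Sum>d\<in>D. F a b c d) = (\<Sum>d\<in>D. \<Sum>c\<in>C. \<Sum>b\<in>B. \<Sum>a\<in>A. F a b c d)"
proof -
  have "(\<Sum>a\<in>A. \<Sum>b\<in>B. \<Sum>c\<in>C. \<Sum>d\<in>D. F a b c d) = (\<Sum>a\<in>A. \<Sum>d\<in>D. \<Sum>c\<in>C. \<Sum>b\<in>B. F a b c d)"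
    by (intro sum.cong refl sum3_rev)
  also have "\<dots> = (\<Sum>d\<in>D. \<Sum>a\<in>A. \<Sum>c\<in>C. \<Sum>b\<in>B. F a b c d)"
    by (rule sum.swap)
  also have "\<dots> = (\<Sum>d\<in>D. \<Sum>c\<in>C. \<Sum>a\<in>A. \<Sum>b\<in>B. F a b c d)"
    by (intro sum.cong refl sum.swap)
  also have "\<dots> = (\<Sum>d\<in>D. \<Sum>c\<in>C. \<Sum>b\<in>B. \<Sum>a\<in>A. F a b c d)"
    by (intro sum.cong refl sum.swap)
  finally show ?thesis .
qed

lemma sum_sandwich_swap:
  fixes h d e :: "'n::finite \<Rightarrow> 'n \<Rightarrow> real"
  assumes h: "\<And>a b. h a b = h b a"
  shows "(\<Sum>i\<in>UNIV. \<Sum>l\<in>UNIV. (\<Sum>m\<in>UNIV. \<Sum>b\<in>UNIV. h i b * d b m * h m l) * e i l)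
       = (\<Sum>i\<in>UNIV. \<Sum>l\<in>UNIV. (\<Sum>m\<in>UNIV. \<Sum>b\<in>UNIV. h i b * e b m * h m l) * d i l)"
proof -
  have "(\<Sum>i\<in>UNIV. \<Sum>l\<in>UNIV. (\<Sum>m\<in>UNIV. \<Sum>b\<in>UNIV. h i b * e b m * h m l) * d i l)
      = (\<Sum>i\<in>UNIV. \<Sum>l\<in>UNIV. \<Sum>m\<in>UNIV. \<Sum>b\<in>UNIV. h b i * d i l * h l m * e b m)"
    unfolding sum_distrib_right
    by (intro sum.cong refl) (simp add: h[of i b for i b] h[of m l for m l] mult_ac)
  also have "\<dots> = (\<Sum>b\<in>UNIV. \<Sum>m\<in>UNIV. \<Sum>l\<in>UNIV. \<Sum>i\<in>UNIV. h b i * d i l * h l m * e b m)"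
    by (rule sum4_rev)
  finally show ?thesis
    by (simp add: sum_distrib_right)
qed

lemma gval_add: "gval g x (V + V') W = gval g x V W + gval g x V' W"
  unfolding gval_def by (simp add: algebra_simps sum.distrib)

lemma gval_diff: "gval g x (V - V') W = gval g x V W - gval g x V' W"
  unfolding gval_def by (simp add: algebra_simps sum_subtractf)

lemma gval_scaleR: "gval g x (c *\<^sub>R V) W = c * gval g x V W"
  unfolding gval_def by (simp add: algebra_simps sum_distrib_left)

lemma gval_zero: "gval g x 0 W = 0"
  unfolding gval_def by simp

lemma oneform_diff: "oneform (\<lambda>y. B y - D y) x V = oneform B x V - oneform D x V"
  unfolding oneform_def by (simp add: algebra_simps sum_subtractf)

lemma oneform_axis: "oneform T x (axis j 1) = T x $ j"
  unfolding oneform_def by (rule sum_mult_axis)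

lemma ricci_axis: "ricci g x (axis j 1) (axis k 1) = Ric g j k x"
  unfolding ricci_def by (simp add: sum_mult_axis)

lemma scal_eq_trace_ricci: "scal g x = (\<Sum>j\<in>UNIV. \<Sum>k\<in>UNIV. ginv g x j k * ricci g x (axis j 1) (axis k 1))"
  unfolding scal_def ricci_axis ..

lemma oneform_dual_vec_eq_trace:
  "oneform T x (dual_vec g T x) = (\<Sum>j\<in>UNIV. \<Sum>k\<in>UNIV. ginv g x j k * T x $ j * T x $ k)"
  unfolding oneform_def dual_vec_def by (simp add: sum_distrib_left mult_ac)

section \<open>The metric and its inverse\<close>

context
  fixes U :: "(real^'n) set" and g :: "real^'n \<Rightarrow> 'n \<Rightarrow> 'n \<Rightarrow> real"
  assumes rm: "riemannian_metric U g"
begin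

lemma riemannian_metric_open: "open U"
  using rm by (simp add: riemannian_metric_def)

lemma riemannian_metric_sym: "y \<in> U \<Longrightarrow> g y i j = g y j i"
  using rm by (simp add: riemannian_metric_def)

lemma riemannian_metric_pos: "y \<in> U \<Longrightarrow> v \<noteq> 0 \<Longrightarrow> gval g y v v > 0"
  using rm by (simp add: riemannian_metric_def gval_def)

lemma riemannian_metric_C3: "Ck 3 U (\<lambda>y. g y i j)"
  using rm by (simp add: riemannian_metric_def smooth_on_def)

lemma metric_differentiable: "y \<in> U \<Longrightarrow> (\<lambda>y. g y i j) differentiable at y"
  using riemannian_metric_C3[of i j] riemannian_metric_open
  by (simp add: numeral_3_eq_3 differentiable_on_eq_differentiable_at)

lemma pd_metric_differentiable: "y \<in> U \<Longrightarrow> pd (\<lambda>y. g y i j) k differentiable at y"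
  using riemannian_metric_C3[of i j] riemannian_metric_open
  by (simp add: numeral_3_eq_3 differentiable_on_eq_differentiable_at)

lemma pd_pd_metric_commute: "x \<in> U \<Longrightarrow> pd (pd (\<lambda>y. g y i j) k) l x = pd (pd (\<lambda>y. g y i j) l) k x"
  using riemannian_metric_C3[of i j]
  by (intro pd_pd_commute[OF riemannian_metric_open])
    (auto simp: numeral_3_eq_3 metric_differentiable pd_metric_differentiable differentiable_imp_continuous_on)

lemma pd_metric_sym: "x \<in> U \<Longrightarrow> pd (\<lambda>y. g y i j) k x = pd (\<lambda>y. g y j i) k x"
  by (rule pd_transform_within_open[OF riemannian_metric_open]) (auto intro: riemannian_metric_sym)

lemma metric_matrix_invertible:
  assumes y: "y \<in> U"
  shows "invertible (\<chi> a b. g y a b)"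
  unfolding invertible_left_inverse matrix_left_invertible_ker
proof (intro allI impI)
  fix v :: "real^'n"
  assume "(\<chi> a b. g y a b) *v v = 0"
  then have ker: "(\<Sum>j\<in>UNIV. g y i j * v$j) = 0" for i
    by (simp add: matrix_vector_mult_def vec_eq_iff)
  have "gval g y v v = (\<Sum>i\<in>UNIV. v$i * (\<Sum>j\<in>UNIV. g y i j * v$j))"
    unfolding gval_def by (simp add: sum_distrib_left mult_ac)
  also have "\<dots> = 0"
    using ker by simp
  finally have "gval g y v v = 0" .
  then show "v = 0"
    using riemannian_metric_pos[OF y, of v] by auto
qed

lemma ginv_left: "y \<in> U \<Longrightarrow> (\<Sum>k\<in>UNIV. ginv g y i k * g y k j) = of_bool (i = j)"
  using invertible_matrix_inv(2)[OF metric_matrix_invertible, of y]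
  by (simp add: ginv_def matrix_matrix_mult_def mat_def vec_eq_iff)

lemma ginv_right: "y \<in> U \<Longrightarrow> (\<Sum>k\<in>UNIV. g y i k * ginv g y k j) = of_bool (i = j)"
  using invertible_matrix_inv(1)[OF metric_matrix_invertible, of y]
  by (simp add: ginv_def matrix_matrix_mult_def mat_def vec_eq_iff)

lemma ginv_sym:
  assumes y: "y \<in> U"
  shows "ginv g y i j = ginv g y j i"
proof -
  have "ginv g y i j = (\<Sum>l\<in>UNIV. (\<Sum>k\<in>UNIV. ginv g y j k * g y k l) * ginv g y i l)"
    by (simp add: ginv_left[OF y])
  also have "\<dots> = (\<Sum>k\<in>UNIV. ginv g y j k * (\<Sum>l\<in>UNIV. ginv g y i l * g y l k))"
    unfolding sum_distrib_left sum_distrib_right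
    by (subst sum.swap) (simp add: riemannian_metric_sym[OF y, of _ k for k] mult_ac)
  also have "\<dots> = ginv g y j i"
    by (simp add: ginv_left[OF y])
  finally show ?thesis .
qed

lemma ginv_cramer:
  assumes y: "y \<in> U"
  shows "ginv g y i j = det (\<chi> a b. if b = i then axis j 1 $ a else g y a b) / det (\<chi> a b. g y a b)"
proof -
  let ?G = "\<chi> a b. g y a b"
  have "?G *v (matrix_inv ?G *v axis j 1) = axis j 1"
    by (simp add: matrix_vector_mul_assoc invertible_matrix_inv(1)[OF metric_matrix_invertible[OF y]])
  moreover have "det ?G \<noteq> 0"
    using metric_matrix_invertible[OF y] invertible_det_nz by blast
  ultimately have "matrix_inv ?G *v axis j 1 = (\<chi> k. det (\<chi> a b. if b = k then axis j 1 $ a else ?G $ a $ b) / det ?G)"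
    using cramer by blast
  then have "(matrix_inv ?G *v axis j 1) $ i = det (\<chi> a b. if b = i then axis j 1 $ a else g y a b) / det ?G"
    by (simp cong: if_cong)
  moreover have "(matrix_inv ?G *v axis j 1) $ i = ginv g y i j"
    unfolding matrix_vector_mult_def ginv_def by (simp add: sum_mult_axis)
  ultimately show ?thesis
    by simp
qed

lemma ginv_differentiable:
  assumes x: "x \<in> U"
  shows "(\<lambda>y. ginv g y i j) differentiable at x"
proof (rule differentiable_transform_within_open[OF _ riemannian_metric_open x])
  show "(\<lambda>y. det (\<chi> a b. if b = i then axis j 1 $ a else g y a b) / det (\<chi> a b. g y a b)) differentiable at x"
  proof (intro differentiable_divide differentiable_det)
    show "(\<lambda>y. (\<chi> a b. if b = i then axis j 1 $ a else g y a b) $ a $ b) differentiable at x" for a b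
      using metric_differentiable[OF x, of a b] by (cases "b = i") simp_all
    show "(\<lambda>y. (\<chi> a b. g y a b) $ a $ b) differentiable at x" for a b
      using metric_differentiable[OF x, of a b] by simp
    show "det (\<chi> a b. g x a b) \<noteq> 0"
      using metric_matrix_invertible[OF x] invertible_det_nz by blast
  qed
qed (simp add: ginv_cramer)

lemma pd_ginv:
  assumes x: "x \<in> U"
  shows "pd (\<lambda>y. ginv g y i l) k x
     = - (\<Sum>m\<in>UNIV. \<Sum>b\<in>UNIV. ginv g x i b * pd (\<lambda>y. g y b m) k x * ginv g x m l)"
proof -
  have product_rule: "(\<Sum>b\<in>UNIV. pd (\<lambda>y. ginv g y i b) k x * g x b m)
      = - (\<Sum>b\<in>UNIV. ginv g x i b * pd (\<lambda>y. g y b m) k x)" for m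
  proof -
    have "0 = pd (\<lambda>y. \<Sum>b\<in>UNIV. ginv g y i b * g y b m) k x"
      using pd_transform_within_open[OF riemannian_metric_open x, of "\<lambda>_. of_bool (i = m)"]
      by (simp add: ginv_left pd_const)
    also have "\<dots> = (\<Sum>b\<in>UNIV. pd (\<lambda>y. ginv g y i b) k x * g x b m + ginv g x i b * pd (\<lambda>y. g y b m) k x)"
      by (simp add: pd_sum pd_mult ginv_differentiable metric_differentiable x)
    finally show ?thesis
      by (simp add: sum.distrib eq_neg_iff_add_eq_0)
  qed
  have "pd (\<lambda>y. ginv g y i l) k x = (\<Sum>b\<in>UNIV. pd (\<lambda>y. ginv g y i b) k x * (\<Sum>m\<in>UNIV. g x b m * ginv g x m l))"
    by (simp add: ginv_right[OF x])
  also have "\<dots> = (\<Sum>m\<in>UNIV. (\<Sum>b\<in>UNIV. pd (\<lambda>y. ginv g y i b) k x * g x b m) * ginv g x m l)"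
    unfolding sum_distrib_left sum_distrib_right by (subst sum.swap) (simp add: mult_ac)
  also have "\<dots> = - (\<Sum>m\<in>UNIV. \<Sum>b\<in>UNIV. ginv g x i b * pd (\<lambda>y. g y b m) k x * ginv g x m l)"
    by (simp add: product_rule sum_distrib_right sum_negf)
  finally show ?thesis .
qed

section \<open>Symmetry of the Ricci tensor\<close>

lemma Chr_sym: "y \<in> U \<Longrightarrow> Chr g l a b y = Chr g l b a y"
  unfolding Chr_def using pd_metric_sym[of y a b] by (simp add: add.commute)

lemma pd_Chr_sym: "x \<in> U \<Longrightarrow> pd (\<lambda>y. Chr g l a b y) c x = pd (\<lambda>y. Chr g l b a y) c x"
  by (rule pd_transform_within_open[OF riemannian_metric_open]) (auto intro: Chr_sym)

lemma Chr_differentiable: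
  assumes x: "x \<in> U"
  shows "(\<lambda>y. Chr g k i j y) differentiable at x"
proof -
  have "(\<lambda>y. ginv g y k l * (pd (\<lambda>y. g y j l) i y + pd (\<lambda>y. g y i l) j y - pd (\<lambda>y. g y i j) l y))
      differentiable at x" for l
    by (intro differentiable_mult differentiable_add differentiable_diff ginv_differentiable[OF x]
        pd_metric_differentiable[OF x])
  then show ?thesis
    unfolding Chr_def by (intro differentiable_mult[OF differentiable_const] differentiable_sum) auto
qed

lemma sum_Chr_trace:
  assumes y: "y \<in> U"
  shows "(\<Sum>i\<in>UNIV. Chr g i i j y) = 1/2 * (\<Sum>i\<in>UNIV. \<Sum>l\<in>UNIV. ginv g y i l * pd (\<lambda>y. g y i l) j y)"
proof -
  have cancel: "(\<Sum>i\<in>UNIV. \<Sum>l\<in>UNIV. ginv g y i l * pd (\<lambda>y. g y i j) l y)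
      = (\<Sum>i\<in>UNIV. \<Sum>l\<in>UNIV. ginv g y i l * pd (\<lambda>y. g y j l) i y)"
    by (subst sum.swap) (simp add: ginv_sym[OF y, of _ l for l] pd_metric_sym[OF y, of j])
  have "(\<Sum>i\<in>UNIV. Chr g i i j y) = 1/2 * ((\<Sum>i\<in>UNIV. \<Sum>l\<in>UNIV. ginv g y i l * pd (\<lambda>y. g y j l) i y)
       + (\<Sum>i\<in>UNIV. \<Sum>l\<in>UNIV. ginv g y i l * pd (\<lambda>y. g y i l) j y)
       - (\<Sum>i\<in>UNIV. \<Sum>l\<in>UNIV. ginv g y i l * pd (\<lambda>y. g y i j) l y))"
    unfolding Chr_def by (simp add: sum_distrib_left sum.distrib sum_subtractf algebra_simps)
  then show ?thesis
    using cancel by simp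
qed

lemma Ric_diff_transpose:
  assumes x: "x \<in> U"
  shows "Ric g j k x - Ric g k j x
       = (\<Sum>i\<in>UNIV. pd (\<lambda>y. Chr g i i j y) k x) - (\<Sum>i\<in>UNIV. pd (\<lambda>y. Chr g i i k y) j x)"
proof -
  have Ric_expand: "Ric g j k x = (\<Sum>i\<in>UNIV. pd (\<lambda>y. Chr g i j k y) i x) - (\<Sum>i\<in>UNIV. pd (\<lambda>y. Chr g i i k y) j x)
      + ((\<Sum>i\<in>UNIV. \<Sum>m\<in>UNIV. Chr g i i m x * Chr g m j k x) - (\<Sum>i\<in>UNIV. \<Sum>m\<in>UNIV. Chr g i j m x * Chr g m i k x))"
    for j k
    unfolding Ric_def Riem_def by (simp add: sum.distrib sum_subtractf)
  have "(\<Sum>i\<in>UNIV. pd (\<lambda>y. Chr g i j k y) i x) = (\<Sum>i\<in>UNIV. pd (\<lambda>y. Chr g i k j y) i x)"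
    by (intro sum.cong refl pd_Chr_sym x)
  moreover have "(\<Sum>i\<in>UNIV. \<Sum>m\<in>UNIV. Chr g i i m x * Chr g m j k x)
      = (\<Sum>i\<in>UNIV. \<Sum>m\<in>UNIV. Chr g i i m x * Chr g m k j x)"
    by (simp add: Chr_sym[OF x, of _ j k])
  moreover have "(\<Sum>i\<in>UNIV. \<Sum>m\<in>UNIV. Chr g i k m x * Chr g m i j x)
      = (\<Sum>i\<in>UNIV. \<Sum>m\<in>UNIV. Chr g i j m x * Chr g m i k x)"
    by (subst sum.swap) (simp add: Chr_sym[OF x] mult.commute)
  ultimately show ?thesis
    using Ric_expand[of j k] Ric_expand[of k j] by simp
qed

lemma pd_sum_Chr_trace:
  assumes x: "x \<in> U"
  shows "(\<Sum>i\<in>UNIV. pd (\<lambda>y. Chr g i i j y) k x) = 1/2 * (\<Sum>i\<in>UNIV. \<Sum>l\<in>UNIV.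
      pd (\<lambda>y. ginv g y i l) k x * pd (\<lambda>y. g y i l) j x + ginv g x i l * pd (pd (\<lambda>y. g y i l) j) k x)"
proof -
  have "(\<Sum>i\<in>UNIV. pd (\<lambda>y. Chr g i i j y) k x) = pd (\<lambda>y. \<Sum>i\<in>UNIV. Chr g i i j y) k x"
    by (simp add: pd_sum Chr_differentiable x)
  also have "\<dots> = pd (\<lambda>y. 1/2 * (\<Sum>i\<in>UNIV. \<Sum>l\<in>UNIV. ginv g y i l * pd (\<lambda>y. g y i l) j y)) k x"
    by (rule pd_transform_within_open[OF riemannian_metric_open x]) (rule sum_Chr_trace)
  also have "\<dots> = 1/2 * pd (\<lambda>y. \<Sum>i\<in>UNIV. \<Sum>l\<in>UNIV. ginv g y i l * pd (\<lambda>y. g y i l) j y) k x"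
    by (rule pd_cmult) (simp add: ginv_differentiable pd_metric_differentiable x)
  also have "pd (\<lambda>y. \<Sum>i\<in>UNIV. \<Sum>l\<in>UNIV. ginv g y i l * pd (\<lambda>y. g y i l) j y) k x
      = (\<Sum>i\<in>UNIV. \<Sum>l\<in>UNIV. pd (\<lambda>y. ginv g y i l * pd (\<lambda>y. g y i l) j y) k x)"
    by (simp add: pd_sum ginv_differentiable pd_metric_differentiable x)
  also have "\<dots> = (\<Sum>i\<in>UNIV. \<Sum>l\<in>UNIV.
      pd (\<lambda>y. ginv g y i l) k x * pd (\<lambda>y. g y i l) j x + ginv g x i l * pd (pd (\<lambda>y. g y i l) j) k x)"
    by (simp add: pd_mult ginv_differentiable pd_metric_differentiable x)
  finally show ?thesis .
qed

lemma Ric_sym: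
  assumes x: "x \<in> U"
  shows "Ric g j k x = Ric g k j x"
proof -
  have first_order: "(\<Sum>i\<in>UNIV. \<Sum>l\<in>UNIV. pd (\<lambda>y. ginv g y i l) k x * pd (\<lambda>y. g y i l) j x)
      = (\<Sum>i\<in>UNIV. \<Sum>l\<in>UNIV. pd (\<lambda>y. ginv g y i l) j x * pd (\<lambda>y. g y i l) k x)"
    using sum_sandwich_swap[of "ginv g x" "\<lambda>b m. pd (\<lambda>y. g y b m) k x" "\<lambda>i l. pd (\<lambda>y. g y i l) j x"]
    by (simp add: pd_ginv[OF x] ginv_sym[OF x] sum_negf)
  have second_order: "(\<Sum>i\<in>UNIV. \<Sum>l\<in>UNIV. ginv g x i l * pd (pd (\<lambda>y. g y i l) j) k x)
      = (\<Sum>i\<in>UNIV. \<Sum>l\<in>UNIV. ginv g x i l * pd (pd (\<lambda>y. g y i l) k) j x)"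
    by (simp add: pd_pd_metric_commute[OF x, of _ _ j k])
  have "Ric g j k x - Ric g k j x = 0"
    unfolding Ric_diff_transpose[OF x] pd_sum_Chr_trace[OF x] using first_order second_order
    by (simp add: sum.distrib)
  then show ?thesis
    by simp
qed

lemma ricci_sym:
  assumes x: "x \<in> U"
  shows "ricci g x V W = ricci g x W V"
  unfolding ricci_def by (subst sum.swap) (simp add: Ric_sym[OF x, of _ k for k] mult_ac)

lemma nablaRic_sym:
  assumes x: "x \<in> U"
  shows "nablaRic g i j k x = nablaRic g i k j x"
proof -
  have "pd (\<lambda>y. Ric g j k y) i x = pd (\<lambda>y. Ric g k j y) i x"
    by (rule pd_transform_within_open[OF riemannian_metric_open x]) (rule Ric_sym)
  then show ?thesis
    unfolding nablaRic_def using Ric_sym[OF x] by (simp add: add.commute)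
qed

lemma nabla_ricci_sym:
  assumes x: "x \<in> U"
  shows "nabla_ricci g x X Z W = nabla_ricci g x X W Z"
proof -
  have "nabla_ricci g x X Z W = (\<Sum>i\<in>UNIV. \<Sum>j\<in>UNIV. \<Sum>k\<in>UNIV. nablaRic g i k j x * X$i * Z$j * W$k)"
    unfolding nabla_ricci_def using nablaRic_sym[OF x] by simp
  also have "\<dots> = (\<Sum>i\<in>UNIV. \<Sum>k\<in>UNIV. \<Sum>j\<in>UNIV. nablaRic g i k j x * X$i * Z$j * W$k)"
    by (intro sum.cong refl sum.swap)
  also have "\<dots> = nabla_ricci g x X W Z"
    unfolding nabla_ricci_def by (simp add: mult_ac)
  finally show ?thesis .
qed

section \<open>Weak Ricci symmetry and quasi-conformal flatness\<close>

lemma metric_ginv_contract: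
  assumes x: "x \<in> U"
  shows "(\<Sum>l\<in>UNIV. g x i l * (\<Sum>j\<in>UNIV. ginv g x l j * c j)) = c i"
proof -
  have "(\<Sum>l\<in>UNIV. g x i l * (\<Sum>j\<in>UNIV. ginv g x l j * c j)) = (\<Sum>j\<in>UNIV. (\<Sum>l\<in>UNIV. g x i l * ginv g x l j) * c j)"
    unfolding sum_distrib_left sum_distrib_right by (subst sum.swap) (simp add: mult_ac)
  then show ?thesis
    by (simp add: ginv_right[OF x])
qed

lemma gval_ricci_op:
  assumes x: "x \<in> U"
  shows "gval g x (ricci_op g x V) W = ricci g x V W"
proof -
  define R where "R j = (\<Sum>k\<in>UNIV. Ric g j k x * V$k)" for j
  have Q: "ricci_op g x V $ i = (\<Sum>j\<in>UNIV. ginv g x i j * R j)" for i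
    unfolding ricci_op_def R_def by (simp add: sum_distrib_left mult.assoc)
  have "gval g x (ricci_op g x V) W = (\<Sum>i\<in>UNIV. \<Sum>l\<in>UNIV. W$l * (g x l i * (\<Sum>j\<in>UNIV. ginv g x i j * R j)))"
    unfolding gval_def Q using riemannian_metric_sym[OF x] by (simp add: mult_ac)
  also have "\<dots> = (\<Sum>l\<in>UNIV. W$l * (\<Sum>i\<in>UNIV. g x l i * (\<Sum>j\<in>UNIV. ginv g x i j * R j)))"
    by (subst sum.swap) (simp add: sum_distrib_left)
  also have "\<dots> = (\<Sum>l\<in>UNIV. W$l * R l)"
    by (simp add: metric_ginv_contract[OF x])
  also have "\<dots> = ricci g x W V"
    by (simp add: R_def ricci_def sum_distrib_left mult_ac)
  finally show ?thesis
    using ricci_sym[OF x] by simp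
qed

lemma metric_dual_vec:
  assumes x: "x \<in> U"
  shows "(\<Sum>l\<in>UNIV. g x i l * dual_vec g T x $ l) = T x $ i"
  unfolding dual_vec_def by (simp add: metric_ginv_contract[OF x])

lemma oneform_dual_vec_pos:
  assumes x: "x \<in> U" and T: "T x \<noteq> 0"
  shows "oneform T x (dual_vec g T x) > 0"
proof -
  let ?\<rho> = "dual_vec g T x"
  have "?\<rho> \<noteq> 0"
  proof
    assume "?\<rho> = 0"
    then have "T x $ i = 0" for i
      using metric_dual_vec[OF x, of i T] by simp
    then show False
      using T by (simp add: vec_eq_iff)
  qed
  moreover have "oneform T x ?\<rho> = gval g x ?\<rho> ?\<rho>"
    unfolding oneform_def gval_def
    by (simp add: metric_dual_vec[OF x, of _ T, symmetric] sum_distrib_left sum_distrib_right mult_ac)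
  ultimately show ?thesis
    using riemannian_metric_pos[OF x] by simp
qed

lemma weakly_ricci_symmetric_oneform_ricci:
  assumes "weakly_ricci_symmetric U g A B D" and x: "x \<in> U"
  shows "oneform (\<lambda>y. B y - D y) x Z * ricci g x X W = oneform (\<lambda>y. B y - D y) x W * ricci g x X Z"
proof -
  have "nabla_ricci g x X Z W = oneform A x X * ricci g x Z W + oneform B x Z * ricci g x X W + oneform D x W * ricci g x X Z"
    "nabla_ricci g x X W Z = oneform A x X * ricci g x W Z + oneform B x W * ricci g x X Z + oneform D x Z * ricci g x X W"
    using assms unfolding weakly_ricci_symmetric_def by blast+
  then show ?thesis
    using nabla_ricci_sym[OF x, of X Z W] ricci_sym[OF x, of W Z]
    by (simp add: oneform_diff left_diff_distrib)
qed

lemma ricci_eq_tensor_square: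
  assumes x: "x \<in> U" and T: "T x \<noteq> 0"
    and TS: "\<And>X Z W. oneform T x Z * ricci g x X W = oneform T x W * ricci g x X Z"
  shows "ricci g x X Z = scal g x / oneform T x (dual_vec g T x) * oneform T x X * oneform T x Z"
proof -
  define \<rho> where "\<rho> = dual_vec g T x"
  define \<tau> where "\<tau> = oneform T x \<rho>"
  have \<tau>: "\<tau> > 0"
    using oneform_dual_vec_pos[of x T] x T by (simp add: \<tau>_def \<rho>_def)
  have factor: "ricci g x X Z = oneform T x Z * ricci g x X \<rho> / \<tau>" for X Z
    using TS[of Z X \<rho>] \<tau> by (simp add: \<tau>_def field_simps)
  define \<kappa> where "\<kappa> = ricci g x \<rho> \<rho> / \<tau>\<^sup>2"
  have rank_one: "ricci g x X Z = \<kappa> * oneform T x X * oneform T x Z" for X Z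
    using factor[of X Z] factor[of \<rho> X] ricci_sym[OF x, of X \<rho>] \<tau>
    by (simp add: \<kappa>_def power2_eq_square field_simps)
  have "scal g x = \<kappa> * \<tau>"
    unfolding scal_eq_trace_ricci rank_one \<tau>_def \<rho>_def oneform_dual_vec_eq_trace oneform_axis
    by (simp add: sum_distrib_left mult_ac)
  then show ?thesis
    using rank_one \<tau> by (simp add: \<tau>_def \<rho>_def)
qed

lemma Rbar_quasi_conformally_flat:
  assumes "quasi_conformally_flat U g a b" "a \<noteq> 0" "CARD('n) > 1" and x: "x \<in> U"
  shows "Rbar g x X Y Z W =
    scal g x / real CARD('n) * (1 / (real CARD('n) - 1) + 2 * b / a)
      * (gval g x Y Z * gval g x X W - gval g x X Z * gval g x Y W)
    - b / a * (ricci g x Y Z * gval g x X W - ricci g x X Z * gval g x Y W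
               + gval g x Y Z * ricci g x X W - gval g x X Z * ricci g x Y W)" (is "_ = ?rhs")
proof -
  have "gval g x (qc_curv g a b x X Y Z) W = 0"
    using assms gval_zero unfolding quasi_conformally_flat_def by simp
  then have "a * Rbar g x X Y Z W =
    scal g x / real CARD('n) * (a / (real CARD('n) - 1) + 2 * b)
      * (gval g x Y Z * gval g x X W - gval g x X Z * gval g x Y W)
    - b * (ricci g x Y Z * gval g x X W - ricci g x X Z * gval g x Y W
           + gval g x Y Z * ricci g x X W - gval g x X Z * ricci g x Y W)" (is "_ = ?E")
    unfolding qc_curv_def Rbar_def
    by (simp add: gval_add gval_diff gval_scaleR gval_ricci_op[OF x] algebra_simps)
  then have "Rbar g x X Y Z W = ?E / a"
    using assms(2) by (metis nonzero_mult_div_cancel_left)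
  also have "\<dots> = ?rhs"
    using assms(2,3) by (simp add: field_simps)
  finally show ?thesis .
qed

end

theorem corollary2p1:
  fixes U :: "(real^'n) set"
    and g :: "real^'n \<Rightarrow> 'n \<Rightarrow> 'n \<Rightarrow> real"
    and A B D :: "real^'n \<Rightarrow> real^'n"
    and a b :: real
  assumes "CARD('n) > 3"
    and "U \<noteq> {}"
    and "riemannian_metric U g"
    and "non_flat U g"
    and "weakly_ricci_symmetric U g A B D"
    and "a \<noteq> 0"
    and "quasi_conformally_flat U g a b"
    and "\<forall>x\<in>U. scal g x \<noteq> 0"
    and "\<forall>x\<in>U. B x - D x \<noteq> 0"
  shows "\<forall>x\<in>U. \<forall>X Y Z W.
    (let n = real CARD('n);
         T = (\<lambda>y. B y - D y);
         \<rho> = dual_vec g T x;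
         l = scal g x / n * (1 / (n - 1) + 2 * b / a);
         \<delta> = - (b / a) * (scal g x / oneform T x \<rho>);
         P = (\<lambda>V1 V2. \<delta> * (oneform B x V1 * oneform B x V2 - oneform B x V1 * oneform D x V2
                             - oneform D x V1 * oneform B x V2 + oneform D x V1 * oneform D x V2))
     in Rbar g x X Y Z W =
          l * (gval g x Y Z * gval g x X W - gval g x X Z * gval g x Y W)
          + gval g x X W * P Y Z - gval g x X Z * P Y W
          + gval g x Y Z * P X W - gval g x Y W * P X Z)"
  apply (intro ballI allI)
  subgoal premises x for x X Y Z W
  proof -
    let ?T = "\<lambda>y. B y - D y"
    have ricci: "ricci g x V V' = scal g x / oneform ?T x (dual_vec g ?T x) * oneform ?T x V * oneform ?T x V'"
      for V V'
      by (rule ricci_eq_tensor_square[OF assms(3) x])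
        (use assms(9) x weakly_ricci_symmetric_oneform_ricci[OF assms(3,5) x] in auto)
    have P: "- (b / a) * (scal g x / oneform ?T x (dual_vec g ?T x))
        * (oneform B x V * oneform B x V' - oneform B x V * oneform D x V'
           - oneform D x V * oneform B x V' + oneform D x V * oneform D x V')
      = - (b / a) * ricci g x V V'" for V V'
    proof -
      have "oneform B x V * oneform B x V' - oneform B x V * oneform D x V'
          - oneform D x V * oneform B x V' + oneform D x V * oneform D x V' = oneform ?T x V * oneform ?T x V'"
        by (simp add: oneform_diff algebra_simps)
      then show ?thesis
        by (simp add: ricci mult_ac)
    qed
    have card: "CARD('n) > 1"
      using assms(1) by simp
    show ?thesis
      unfolding Let_def P Rbar_quasi_conformally_flat[OF assms(3,7,6) card x]
      by (simp add: algebra_simps)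
  qed
  done

end
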